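(* Let $N\ge2$. Let $G$ be the group of bijections of $\{1,\dots,N\}^3$ generated by (i) the interchanges of two parallel layers, i.e. the maps $(i,j,k)\mapsto(\tau(i),j,k)$, $(i,j,k)\mapsto(i,\tau(j),k)$, $(i,j,k)\mapsto(i,j,\tau(k))$ for transpositions $\tau$ of $\{1,\dots,N\}$; (ii) the 24 rotational symmetries of the cube $[1,N]^3$ restricted to its lattice points; (iii) the reflectional symmetries of the cube $[1,N]^3$ restricted to its lattice points. Let $H$ be the group of all bijections $f$ of $\{1,\dots,N\}^3$ such that whenever eight points form the vertex set of a box, their images under $f$ also form the vertex set of a box. Then $G\subseteq H$; if $N=2$, $H$ is strictly larger than $G$; and if $N\ge3$, $H=G$.
   Context: A (rectangular) box in the grid $\{1,\dots,N\}^3$ is a set $\{i_1,i_2\}\times\{j_1,j_2\}\times\{k_1,k_2\}$ with $i_1\neq i_2$, $j_1\neq j_2$, $k_1\neq k_2$. *)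

theory Defs
  imports
    "HOL-Analysis.Analysis"
    "HOL-Algebra.Bij"
    "HOL-Algebra.Generated_Groups"
    "HOL-Combinatorics.Transposition"
begin

type_synonym point = "nat \<times> nat \<times> nat"

definition grid :: "nat \<Rightarrow> point set" where
  "grid N = {1..N} \<times> {1..N} \<times> {1..N}"

definition is_box :: "nat \<Rightarrow> point set \<Rightarrow> bool" where
  "is_box N B \<longleftrightarrow> (\<exists>i1\<in>{1..N}. \<exists>i2\<in>{1..N}. \<exists>j1\<in>{1..N}. \<exists>j2\<in>{1..N}. \<exists>k1\<in>{1..N}. \<exists>k2\<in>{1..N}.
     i1 \<noteq> i2 \<and> j1 \<noteq> j2 \<and> k1 \<noteq> k2 \<and> B = {i1, i2} \<times> {j1, j2} \<times> {k1, k2})"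

text \<open>
  Bijections of the grid are elements of \<^term>\<open>Bij (grid N)\<close>, hence extensional functions;
  this is why the maps below are restricted to the grid.
\<close>

definition layer_interchanges :: "nat \<Rightarrow> (point \<Rightarrow> point) set" where
  "layer_interchanges N =
     (\<Union>a\<in>{1..N}. \<Union>b\<in>{1..N} - {a}.
       {\<lambda>(i, j, k)\<in>grid N. (Transposition.transpose a b i, j, k),
        \<lambda>(i, j, k)\<in>grid N. (i, Transposition.transpose a b j, k),
        \<lambda>(i, j, k)\<in>grid N. (i, j, Transposition.transpose a b k)})"

definition solid_cube :: "nat \<Rightarrow> (real ^ 3) set" where
  "solid_cube N = cbox (\<chi> _. 1) (\<chi> _. real N)"

fun embed :: "point \<Rightarrow> real ^ 3" where
  "embed (i, j, k) = vector [real i, real j, real k]"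

text \<open>Orientation-preserving isometries and reflections in planes of Euclidean 3-space.\<close>

definition is_rotation :: "(real ^ 3 \<Rightarrow> real ^ 3) \<Rightarrow> bool" where
  "is_rotation g \<longleftrightarrow> (\<exists>A b. rotation_matrix A \<and> g = (\<lambda>x. A *v x + b))"

definition is_reflection :: "(real ^ 3 \<Rightarrow> real ^ 3) \<Rightarrow> bool" where
  "is_reflection g \<longleftrightarrow>
     (\<exists>n p. n \<noteq> 0 \<and> g = (\<lambda>x. x - (2 * ((x - p) \<bullet> n) / (n \<bullet> n)) *\<^sub>R n))"

definition restricts_to :: "nat \<Rightarrow> (real ^ 3 \<Rightarrow> real ^ 3) \<Rightarrow> (point \<Rightarrow> point) \<Rightarrow> bool" where
  "restricts_to N g f \<longleftrightarrow> (\<forall>p\<in>grid N. embed (f p) = g (embed p))"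

definition rotational_symmetries :: "nat \<Rightarrow> (point \<Rightarrow> point) set" where
  "rotational_symmetries N =
     {f \<in> Bij (grid N). \<exists>g. is_rotation g \<and> g ` solid_cube N = solid_cube N \<and> restricts_to N g f}"

definition reflectional_symmetries :: "nat \<Rightarrow> (point \<Rightarrow> point) set" where
  "reflectional_symmetries N =
     {f \<in> Bij (grid N). \<exists>g. is_reflection g \<and> g ` solid_cube N = solid_cube N \<and> restricts_to N g f}"

definition cube_group :: "nat \<Rightarrow> (point \<Rightarrow> point) set" where
  "cube_group N = generate (BijGroup (grid N))
     (layer_interchanges N \<union> rotational_symmetries N \<union> reflectional_symmetries N)"

definition box_group :: "nat \<Rightarrow> (point \<Rightarrow> point) set" where
  "box_group N = {f \<in> Bij (grid N). \<forall>B. is_box N B \<longrightarrow> is_box N (f ` B)}"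

end

(* All three groups are compared with the group of bijections preserving the Hamming distance d.
   A box is a Hamming interval {x. d p x + d x r = 3} with d p r = 3, so Hamming isometries preserve boxes.
   Conversely, exactly (N-1)^(3 - d p q) boxes contain both p and q; for N >= 3 this number determines d p q,
   and a box-preserving bijection preserves it. The generators are Hamming isometries: a cube symmetry
   has a linear part whose rows have Euclidean norm 1 and, by comparing opposite vertices of the cube,
   absolute sum at most 1, so it is a signed permutation matrix. Finally a Hamming isometry can be
   composed with layer interchanges and axis swaps until it fixes every point on the three axes through
   (1,1,1), and distances to these points determine all other points. *)
theory Submission
  imports Defs "HOL-Combinatorics.Permutations"
begin

section \<open>Hamming distance, and boxes as its intervals\<close>

fun hdist :: "point \<Rightarrow> point \<Rightarrow> nat" where
  "hdist (a, b, c) (x, y, z) = of_bool (a \<noteq> x) + of_bool (b \<noteq> y) + of_bool (c \<noteq> z)"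

text \<open>The 3 is the diameter of the Hamming metric. For \<open>hdist p r = 3\<close> this is
  the metric interval between p and r, the box with p and r as opposite vertices; it ranges over all
  triples of naturals, so membership in the grid is a separate matter.\<close>

definition interval :: "point \<Rightarrow> point \<Rightarrow> point set" where
  "interval p r = {x. hdist p x + hdist x r = 3}"

definition hamming_group :: "nat \<Rightarrow> (point \<Rightarrow> point) set" where
  "hamming_group N = {f \<in> Bij (grid N). \<forall>p\<in>grid N. \<forall>q\<in>grid N. hdist (f p) (f q) = hdist p q}"

declare hdist.simps [simp del]

lemma hdist_eq_0_iff [simp]: "hdist p q = 0 \<longleftrightarrow> p = q"
  by (cases p; cases q) (auto simp: hdist.simps)

lemma hdist_le_3: "hdist p q \<le> 3"
  by (cases p; cases q) (auto simp: hdist.simps)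

lemma hdist_eq_3_iff: "hdist (a, b, c) (x, y, z) = 3 \<longleftrightarrow> a \<noteq> x \<and> b \<noteq> y \<and> c \<noteq> z"
  by (auto simp: hdist.simps of_bool_def)

text \<open>A coordinate adds 1 to the sum of the two distances if it agrees with one of the two
  distinct end values, and 2 if it agrees with neither. The total attains its minimum 3 only if all
  three coordinates agree with an end value.\<close>

lemma interval_eq:
  assumes "a \<noteq> x" "b \<noteq> y" "c \<noteq> z"
  shows "interval (a, b, c) (x, y, z) = {a, x} \<times> {b, y} \<times> {c, z}"
proof -
  have coord: "of_bool (a \<noteq> u) + of_bool (u \<noteq> x) = (if u \<in> {a, x} then 1 else 2 :: nat)"
    if "a \<noteq> x" for a u x :: nat
    using that by (cases "u = a"; cases "u = x") auto
  have dist: "hdist (a, b, c) (u, v, w) + hdist (u, v, w) (x, y, z) =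
      (if u \<in> {a, x} then 1 else 2) + (if v \<in> {b, y} then 1 else 2) + (if w \<in> {c, z} then 1 else 2)"
    for u v w
    unfolding hdist.simps coord[OF assms(1), symmetric] coord[OF assms(2), symmetric] coord[OF assms(3), symmetric]
    by linarith
  have sum3: "(if P then 1 else 2) + (if Q then 1 else 2) + (if R then 1 else 2) = (3 :: nat) \<longleftrightarrow> P \<and> Q \<and> R"
    for P Q R by simp
  have mem: "(u, v, w) \<in> interval (a, b, c) (x, y, z) \<longleftrightarrow> (u, v, w) \<in> {a, x} \<times> {b, y} \<times> {c, z}" for u v w
    unfolding interval_def mem_Collect_eq dist sum3 mem_Times_iff fst_conv snd_conv ..
  show ?thesis
  proof (rule Set.set_eqI)
    show "p \<in> interval (a, b, c) (x, y, z) \<longleftrightarrow> p \<in> {a, x} \<times> {b, y} \<times> {c, z}" for p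
      using mem[of "fst p" "fst (snd p)" "snd (snd p)"] by (simp only: prod.collapse)
  qed
qed

text \<open>This turns boxes into a metric notion, so that distance preservation alone yields box
  preservation.\<close>

lemma is_box_iff_interval:
  "is_box N B \<longleftrightarrow> (\<exists>p\<in>grid N. \<exists>r\<in>grid N. hdist p r = 3 \<and> B = interval p r)"
proof
  assume "is_box N B"
  then obtain a x b y c z where "a \<in> {1..N}" "x \<in> {1..N}" "b \<in> {1..N}" "y \<in> {1..N}" "c \<in> {1..N}" "z \<in> {1..N}"
    and ne: "a \<noteq> x" "b \<noteq> y" "c \<noteq> z" and B: "B = {a, x} \<times> {b, y} \<times> {c, z}"
    unfolding is_box_def by (elim bexE conjE) (rule that)
  then have gr: "(a, b, c) \<in> grid N" "(x, y, z) \<in> grid N" by (simp_all add: grid_def)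
  have "hdist (a, b, c) (x, y, z) = 3" using ne by (simp add: hdist_eq_3_iff)
  then show "\<exists>p\<in>grid N. \<exists>r\<in>grid N. hdist p r = 3 \<and> B = interval p r"
    using gr B interval_eq[OF ne] by metis
next
  assume "\<exists>p\<in>grid N. \<exists>r\<in>grid N. hdist p r = 3 \<and> B = interval p r"
  then obtain a b c x y z where gr: "(a, b, c) \<in> grid N" "(x, y, z) \<in> grid N"
    and d: "hdist (a, b, c) (x, y, z) = 3" and B: "B = interval (a, b, c) (x, y, z)"
    by (metis prod_cases3)
  have ne: "a \<noteq> x" "b \<noteq> y" "c \<noteq> z" using d unfolding hdist_eq_3_iff by auto
  have mem: "a \<in> {1..N}" "x \<in> {1..N}" "b \<in> {1..N}" "y \<in> {1..N}" "c \<in> {1..N}" "z \<in> {1..N}"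
    using gr by (simp_all add: grid_def)
  have B': "B = {a, x} \<times> {b, y} \<times> {c, z}" unfolding B by (rule interval_eq[OF ne])
  show "is_box N B" unfolding is_box_def
    by (rule bexI[of _ a], rule bexI[of _ x], rule bexI[of _ b], rule bexI[of _ y],
        rule bexI[of _ c], rule bexI[of _ z])
      (simp_all only: ne mem B' simp_thms not_False_eq_True)
qed

lemma interval_subset_grid:
  assumes "p \<in> grid N" "r \<in> grid N" "hdist p r = 3"
  shows "interval p r \<subseteq> grid N"
  using assms by (cases p; cases r) (auto simp: hdist_eq_3_iff interval_eq grid_def )

lemma is_box_subset_grid: "is_box N B \<Longrightarrow> B \<subseteq> grid N"
  using interval_subset_grid unfolding is_box_iff_interval by blast

lemma finite_grid [simp]: "finite (grid N)"
  by (simp add: grid_def)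

lemma finite_boxes: "finite {B. is_box N B}"
  by (rule finite_subset[of _ "Pow (grid N)"]) (use is_box_subset_grid in auto)

section \<open>Box-preserving and distance-preserving bijections as groups\<close>

lemma BijD:
  assumes "f \<in> Bij S"
  shows "inj_on f S" "f ` S = S" "\<And>p. p \<in> S \<Longrightarrow> f p \<in> S" "f \<in> extensional S"
  using assms by (auto simp: Bij_def bij_betw_def)

text \<open>Distances carry over from x to \<open>f x\<close> and back. For the inclusion from right
  to left, a point of the image interval lies in the grid and therefore has a preimage, to which the
  distances are pulled back.\<close>

lemma interval_image:
  assumes f: "f \<in> hamming_group N" and pr: "p \<in> grid N" "r \<in> grid N" "hdist p r = 3"
  shows "f ` interval p r = interval (f p) (f r)"
proof -
  from f have B: "f \<in> Bij (grid N)"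
    and d: "\<And>p q. p \<in> grid N \<Longrightarrow> q \<in> grid N \<Longrightarrow> hdist (f p) (f q) = hdist p q"
    by (auto simp: hamming_group_def)
  note fB = BijD[OF B]
  have fpr: "interval (f p) (f r) \<subseteq> grid N"
    by (intro interval_subset_grid) (use fB pr d in auto)
  show ?thesis
  proof (intro equalityI subsetI)
    fix y assume "y \<in> f ` interval p r"
    then obtain x where x: "x \<in> interval p r" "y = f x" by auto
    then have "x \<in> grid N" using interval_subset_grid[OF pr] by auto
    then show "y \<in> interval (f p) (f r)" using x d pr by (simp add: interval_def)
  next
    fix y assume y: "y \<in> interval (f p) (f r)"
    then obtain x where x: "x \<in> grid N" "y = f x" using fpr fB(2) by blast
    then have "x \<in> interval p r" using y d pr by (simp add: interval_def)
    then show "y \<in> f ` interval p r" using x by auto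
  qed
qed

lemma hamming_group_subset_box_group: "hamming_group N \<subseteq> box_group N"
proof
  fix f assume f: "f \<in> hamming_group N"
  then have B: "f \<in> Bij (grid N)" by (auto simp: hamming_group_def)
  have "is_box N (f ` B)" if "is_box N B" for B
  proof -
    from that obtain p r where pr: "p \<in> grid N" "r \<in> grid N" "hdist p r = 3" "B = interval p r"
      by (auto simp: is_box_iff_interval)
    then have "f ` B = interval (f p) (f r)" using interval_image[OF f] by auto
    moreover have "hdist (f p) (f r) = 3" using f pr by (auto simp: hamming_group_def)
    ultimately show ?thesis using BijD(3)[OF B] pr unfolding is_box_iff_interval by blast
  qed
  with B show "f \<in> box_group N" by (auto simp: box_group_def)
qed

text \<open>The definition of \<open>box_group\<close> asks for boxes to go to boxes in one
  direction only. Since f acts injectively on the finite set of boxes, it also acts surjectively, so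
  every box is the image of a box.\<close>

lemma box_image_bij:
  assumes "f \<in> box_group N"
  shows "bij_betw ((`) f) {B. is_box N B} {B. is_box N B}"
proof -
  have B: "f \<in> Bij (grid N)" using assms by (simp add: box_group_def)
  have inj: "inj_on ((`) f) {B. is_box N B}"
    using inj_on_image_eq_iff[OF BijD(1)[OF B]] is_box_subset_grid by (auto intro!: inj_onI)
  have "(`) f ` {B. is_box N B} \<subseteq> {B. is_box N B}" using assms by (auto simp: box_group_def)
  with inj show ?thesis by (simp add: bij_betw_def endo_inj_surj finite_boxes)
qed

lemma subgroup_BijGroup:
  assumes "H \<subseteq> Bij S" "(\<lambda>x\<in>S. x) \<in> H"
    and "\<And>f g. f \<in> H \<Longrightarrow> g \<in> H \<Longrightarrow> compose S f g \<in> H"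
    and "\<And>f. f \<in> H \<Longrightarrow> (\<lambda>x\<in>S. inv_into S f x) \<in> H"
  shows "subgroup H (BijGroup S)"
proof (rule group.subgroupI[OF group_BijGroup])
  show "H \<subseteq> carrier (BijGroup S)" using assms by (auto simp: BijGroup_def)
  show "H \<noteq> {}" using assms by auto
  show "inv\<^bsub>BijGroup S\<^esub> f \<in> H" if "f \<in> H" for f
    using that assms by (subst inv_BijGroup) auto
  show "f \<otimes>\<^bsub>BijGroup S\<^esub> g \<in> H" if "f \<in> H" "g \<in> H" for f g
    using that assms(1,3) by (auto simp: BijGroup_def)
qed

lemma subgroup_box_group: "subgroup (box_group N) (BijGroup (grid N))"
proof (rule subgroup_BijGroup)
  show "box_group N \<subseteq> Bij (grid N)" by (auto simp: box_group_def)
  have "(\<lambda>x\<in>grid N. x) ` B = B" if "is_box N B" for B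
    using is_box_subset_grid[OF that] by (force simp: image_iff)
  then show "(\<lambda>x\<in>grid N. x) \<in> box_group N"
    by (simp add: box_group_def id_Bij)
next
  fix f g assume fg: "f \<in> box_group N" "g \<in> box_group N"
  have "compose (grid N) f g ` B = f ` g ` B" if "is_box N B" for B
    using is_box_subset_grid[OF that] by (auto simp: compose_def image_image intro!: image_cong)
  with fg show "compose (grid N) f g \<in> box_group N"
    by (auto simp: box_group_def compose_Bij)
next
  fix f assume f: "f \<in> box_group N"
  then have B: "f \<in> Bij (grid N)" by (simp add: box_group_def)
  have "is_box N ((\<lambda>x\<in>grid N. inv_into (grid N) f x) ` B)" if "is_box N B" for B
  proof -
    \<comment> \<open>Closure under inverses rests on finiteness: the inverse sends B to the box C
      whose image B is.\<close>
    have "B \<in> (`) f ` {B. is_box N B}"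
      using box_image_bij[OF f] that by (simp add: bij_betw_def)
    then obtain C where C: "is_box N C" "B = f ` C" by auto
    have "(\<lambda>x\<in>grid N. inv_into (grid N) f x) ` B = inv_into (grid N) f ` B"
      using is_box_subset_grid[OF that] by auto
    also have "\<dots> = C"
      using C is_box_subset_grid[OF C(1)] BijD(1)[OF B] by (simp add: inv_into_image_cancel)
    finally show ?thesis using C by simp
  qed
  then show "(\<lambda>x\<in>grid N. inv_into (grid N) f x) \<in> box_group N"
    using B by (auto simp: box_group_def restrict_inv_into_Bij)
qed

lemma subgroup_hamming_group: "subgroup (hamming_group N) (BijGroup (grid N))"
proof (rule subgroup_BijGroup)
  show "hamming_group N \<subseteq> Bij (grid N)" by (auto simp: hamming_group_def)
  show "(\<lambda>x\<in>grid N. x) \<in> hamming_group N"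
    using id_Bij[of "grid N"] by (auto simp: hamming_group_def)
next
  fix f g assume "f \<in> hamming_group N" "g \<in> hamming_group N"
  then show "compose (grid N) f g \<in> hamming_group N"
    using BijD(3)[of g "grid N"] by (simp add: hamming_group_def compose_Bij compose_eq)
next
  fix f assume f: "f \<in> hamming_group N"
  then have B: "f \<in> Bij (grid N)" by (simp add: hamming_group_def)
  have "inv_into (grid N) f p \<in> grid N" "f (inv_into (grid N) f p) = p" if "p \<in> grid N" for p
    using that BijD(2)[OF B] by (auto simp: inv_into_into f_inv_into_f)
  then show "(\<lambda>x\<in>grid N. inv_into (grid N) f x) \<in> hamming_group N"
    using f B by (simp add: hamming_group_def restrict_inv_into_Bij) metis
qed

section \<open>Counting the boxes through two points\<close>

text \<open>The vertex opposite p takes the other of the two values in each coordinate. Thus any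
  vertex of a box can serve as an endpoint of the interval, not just the pair chosen first.\<close>

lemma interval_opposite:
  assumes st: "s \<in> grid N" "t \<in> grid N" "hdist s t = 3" and p: "p \<in> interval s t"
  obtains r where "r \<in> grid N" "hdist p r = 3" "interval s t = interval p r"
proof -
  obtain i1 j1 k1 i2 j2 k2 where s: "s = (i1, j1, k1)" and t: "t = (i2, j2, k2)"
    by (metis prod_cases3)
  obtain a b c where abc: "p = (a, b, c)" by (metis prod_cases3)
  have ne: "i1 \<noteq> i2" "j1 \<noteq> j2" "k1 \<noteq> k2" using st(3) unfolding s t hdist_eq_3_iff by auto
  have I: "interval s t = {i1, i2} \<times> {j1, j2} \<times> {k1, k2}"
    unfolding s t by (rule interval_eq[OF ne])
  have other: "\<exists>i'\<in>{i, j}. a \<noteq> i' \<and> {i, j} = {a, i'}" if "a \<in> {i, j}" "i \<noteq> j" for a i j :: nat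
    using that by auto
  have "a \<in> {i1, i2}" "b \<in> {j1, j2}" "c \<in> {k1, k2}"
    using p unfolding I abc mem_Times_iff fst_conv snd_conv by blast+
  then obtain i j k where ijk: "i \<in> {i1, i2}" "j \<in> {j1, j2}" "k \<in> {k1, k2}"
    and ne': "a \<noteq> i" "b \<noteq> j" "c \<noteq> k"
    and eq: "{i1, i2} = {a, i}" "{j1, j2} = {b, j}" "{k1, k2} = {c, k}"
    using other ne by metis
  have "(i, j, k) \<in> interval s t" unfolding I mem_Times_iff fst_conv snd_conv using ijk by blast
  then have "(i, j, k) \<in> grid N" using interval_subset_grid[OF st] by blast
  moreover have "hdist p (i, j, k) = 3" unfolding abc hdist_eq_3_iff using ne' by blast
  moreover have "interval s t = interval p (i, j, k)"
    unfolding I abc interval_eq[OF ne'] eq ..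
  ultimately show thesis by (rule that)
qed

text \<open>A box through p is determined by its vertex r opposite p. It contains q iff r agrees
  with q wherever q differs from p; in each of the remaining \<open>3 - hdist p q\<close>
  coordinates, r may take any of the \<open>N - 1\<close> values other than that of p.\<close>

lemma card_boxes_through:
  assumes p: "p \<in> grid N" and q: "q \<in> grid N"
  shows "card {B. is_box N B \<and> p \<in> B \<and> q \<in> B} = (N - 1) ^ (3 - hdist p q)"
proof -
  obtain a b c where abc: "p = (a, b, c)" by (cases p)
  obtain x y z where xyz: "q = (x, y, z)" by (cases q)
  let ?R = "{r \<in> grid N. hdist p r = 3 \<and> q \<in> interval p r}"
  have "bij_betw (interval p) ?R {B. is_box N B \<and> p \<in> B \<and> q \<in> B}"
  proof (rule bij_betw_imageI)
    show "inj_on (interval p) ?R"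
    proof (rule inj_onI)
      \<comment> \<open>The only point of \<open>interval p s\<close> at distance 3 from p is
        s.\<close>
      fix r s assume rs: "r \<in> ?R" "s \<in> ?R" "interval p r = interval p s"
      have "r \<in> interval p r" using rs(1) by (simp add: interval_def)
      then have "r \<in> interval p s" unfolding rs(3) .
      moreover have "hdist p r = 3" using rs(1) by simp
      ultimately show "r = s" by (simp add: interval_def)
    qed
    show "interval p ` ?R = {B. is_box N B \<and> p \<in> B \<and> q \<in> B}"
    proof (intro equalityI subsetI)
      fix B assume "B \<in> interval p ` ?R"
      then show "B \<in> {B. is_box N B \<and> p \<in> B \<and> q \<in> B}"
        using p by (auto simp: is_box_iff_interval interval_def)
    next
      fix B assume B: "B \<in> {B. is_box N B \<and> p \<in> B \<and> q \<in> B}"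
      then obtain s t where "s \<in> grid N" "t \<in> grid N" "hdist s t = 3" "B = interval s t"
        unfolding is_box_iff_interval by blast
      moreover from this obtain r where "r \<in> grid N" "hdist p r = 3" "B = interval p r"
        using interval_opposite[of s N t p] B by auto
      ultimately show "B \<in> interval p ` ?R" using B by auto
    qed
  qed
  then have "card {B. is_box N B \<and> p \<in> B \<and> q \<in> B} = card ?R"
    by (rule bij_betw_same_card[symmetric])
  also have "?R = {i\<in>{1..N} - {a}. x = a \<or> x = i} \<times> {j\<in>{1..N} - {b}. y = b \<or> y = j}
      \<times> {k\<in>{1..N} - {c}. z = c \<or> z = k}" (is "_ = ?I \<times> ?J \<times> ?K")
  proof (rule Set.set_eqI)
    fix r :: point
    obtain i j k where r: "r = (i, j, k)" by (metis prod_cases3)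
    have "q \<in> interval p r \<longleftrightarrow> (x = a \<or> x = i) \<and> (y = b \<or> y = j) \<and> (z = c \<or> z = k)"
      if "a \<noteq> i" "b \<noteq> j" "c \<noteq> k"
      unfolding abc xyz r interval_eq[OF that] mem_Times_iff fst_conv snd_conv by blast
    then show "r \<in> ?R \<longleftrightarrow> r \<in> ?I \<times> ?J \<times> ?K"
      unfolding mem_Collect_eq r abc hdist_eq_3_iff grid_def mem_Times_iff fst_conv snd_conv Diff_iff
        singleton_iff by metis
  qed
  also have "card \<dots> = (N - 1) ^ (3 - hdist p q)"
  proof -
    have *: "card {i\<in>{1..N} - {a}. x = a \<or> x = i} = (if a = x then N - 1 else 1)"
      if "a \<in> {1..N}" "x \<in> {1..N}" for a x
    proof (cases "a = x")
      case True
      then have "{i\<in>{1..N} - {a}. x = a \<or> x = i} = {1..N} - {a}" by auto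
      then show ?thesis using that True by (simp add: card_Diff_singleton)
    next
      case False
      then have "{i\<in>{1..N} - {a}. x = a \<or> x = i} = {x}" using that by auto
      then show ?thesis using False by simp
    qed
    have m: "a \<in> {1..N}" "x \<in> {1..N}" "b \<in> {1..N}" "y \<in> {1..N}" "c \<in> {1..N}" "z \<in> {1..N}"
      using p q by (auto simp: abc xyz grid_def)
    show ?thesis unfolding card_cartesian_product *[OF m(1,2)] *[OF m(3,4)] *[OF m(5,6)]
      by (auto simp: abc xyz hdist.simps power_eq_if numeral_3_eq_3)
  qed
  finally show ?thesis .
qed

lemma box_group_subset_hamming_group:
  assumes "N \<ge> 3"
  shows "box_group N \<subseteq> hamming_group N"
proof
  fix f assume f: "f \<in> box_group N"
  then have B: "f \<in> Bij (grid N)" by (simp add: box_group_def)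
  have "hdist (f p) (f q) = hdist p q" if pq: "p \<in> grid N" "q \<in> grid N" for p q
  proof -
    have mem: "f x \<in> f ` B \<longleftrightarrow> x \<in> B" if "is_box N B" "x \<in> grid N" for x B
      using that is_box_subset_grid[of N B] inj_on_image_mem_iff[OF BijD(1)[OF B], of x B] by auto
    have bij: "bij_betw ((`) f) {B. is_box N B} {B. is_box N B}" by (rule box_image_bij[OF f])
    \<comment> \<open>Every box through \<open>f p\<close> and \<open>f q\<close> is the image of
      some box, by \<open>box_image_bij\<close>, and injectivity of f puts p and q into that
      box.\<close>
    have img: "(`) f ` {B. is_box N B \<and> p \<in> B \<and> q \<in> B} = {B. is_box N B \<and> f p \<in> B \<and> f q \<in> B}"
    proof (intro equalityI subsetI)
      fix C assume "C \<in> (`) f ` {B. is_box N B \<and> p \<in> B \<and> q \<in> B}"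
      then show "C \<in> {B. is_box N B \<and> f p \<in> B \<and> f q \<in> B}"
        using f by (auto simp: box_group_def)
    next
      fix C assume C: "C \<in> {B. is_box N B \<and> f p \<in> B \<and> f q \<in> B}"
      then have "C \<in> (`) f ` {B. is_box N B}" using bij by (simp add: bij_betw_def)
      then obtain D where "is_box N D" "C = f ` D" by auto
      then show "C \<in> (`) f ` {B. is_box N B \<and> p \<in> B \<and> q \<in> B}" using C mem pq by auto
    qed
    have inj: "inj_on ((`) f) {B. is_box N B \<and> p \<in> B \<and> q \<in> B}"
      using bij by (auto simp: bij_betw_def inj_on_def)
    have "card {B. is_box N B \<and> f p \<in> B \<and> f q \<in> B} = card {B. is_box N B \<and> p \<in> B \<and> q \<in> B}"
      using card_image[OF inj] unfolding img .
    then have "(N - 1) ^ (3 - hdist (f p) (f q)) = (N - 1) ^ (3 - hdist p q)"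
      using pq BijD(3)[OF B] by (simp add: card_boxes_through)
    \<comment> \<open>Here \<open>N \<ge> 3\<close> enters: the base \<open>N - 1\<close> exceeds 1,
      so the exponent can be read off. The truncated subtraction loses nothing because distances are
      at most 3.\<close>
    then have "3 - hdist (f p) (f q) = 3 - hdist p q"
      using assms by (subst (asm) power_inject_exp) auto
    then show ?thesis using hdist_le_3[of p q] hdist_le_3[of "f p" "f q"] by linarith
  qed
  with B show "f \<in> hamming_group N" by (auto simp: hamming_group_def)
qed

section \<open>The generators of the cube group are Hamming isometries\<close>

text \<open>Bijectivity comes for free: distance 0 means equality, so f is injective, and an
  injective self-map of a finite set is onto.\<close>

lemma hamming_groupI:
  assumes "f \<in> extensional (grid N)" "\<And>p. p \<in> grid N \<Longrightarrow> f p \<in> grid N"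
    and d: "\<And>p q. p \<in> grid N \<Longrightarrow> q \<in> grid N \<Longrightarrow> hdist (f p) (f q) = hdist p q"
  shows "f \<in> hamming_group N"
proof -
  have "inj_on f (grid N)"
    using d by (metis hdist_eq_0_iff inj_onI)
  moreover have "f ` grid N \<subseteq> grid N" using assms(2) by auto
  ultimately have "bij_betw f (grid N) (grid N)"
    by (simp add: bij_betw_def endo_inj_surj)
  then show ?thesis using assms by (simp add: hamming_group_def Bij_def)
qed

text \<open>A common shape for the layer interchanges and all their products.\<close>

definition coord_map :: "nat \<Rightarrow> (nat \<Rightarrow> nat) \<Rightarrow> (nat \<Rightarrow> nat) \<Rightarrow> (nat \<Rightarrow> nat) \<Rightarrow> point \<Rightarrow> point" where
  "coord_map N \<alpha> \<beta> \<gamma> = (\<lambda>(i, j, k)\<in>grid N. (\<alpha> i, \<beta> j, \<gamma> k))"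

lemma coord_map_apply:
  "(i, j, k) \<in> grid N \<Longrightarrow> coord_map N \<alpha> \<beta> \<gamma> (i, j, k) = (\<alpha> i, \<beta> j, \<gamma> k)"
  by (simp add: coord_map_def)

lemma coord_map_hamming:
  assumes "\<alpha> permutes {1..N}" "\<beta> permutes {1..N}" "\<gamma> permutes {1..N}"
  shows "coord_map N \<alpha> \<beta> \<gamma> \<in> hamming_group N"
proof (rule hamming_groupI)
  show "coord_map N \<alpha> \<beta> \<gamma> \<in> extensional (grid N)" by (simp add: coord_map_def)
  show "coord_map N \<alpha> \<beta> \<gamma> p \<in> grid N" if "p \<in> grid N" for p
    using that assms[THEN permutes_in_image] by (cases p) (auto simp: coord_map_apply grid_def)
  show "hdist (coord_map N \<alpha> \<beta> \<gamma> p) (coord_map N \<alpha> \<beta> \<gamma> q) = hdist p q"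
    if "p \<in> grid N" "q \<in> grid N" for p q
    using that assms[THEN permutes_inj, THEN inj_eq]
    by (cases p; cases q) (simp add: coord_map_apply hdist.simps)
qed

lemma layer_interchanges_eq:
  "layer_interchanges N = (\<Union>a\<in>{1..N}. \<Union>b\<in>{1..N} - {a}.
     {coord_map N (Transposition.transpose a b) id id, coord_map N id (Transposition.transpose a b) id,
      coord_map N id id (Transposition.transpose a b)})"
  by (simp add: layer_interchanges_def coord_map_def)

lemma layer_interchanges_subset: "layer_interchanges N \<subseteq> hamming_group N"
  unfolding layer_interchanges_eq
  by (auto intro!: coord_map_hamming permutes_swap_id permutes_id)

text \<open>The square of the absolute sum is the sum of squares, which is 1, plus twice the
  absolute pairwise products. As it is at most 1, all pairwise products vanish.\<close>

lemma one_nonzero_coordinate: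
  fixes a b c :: real
  assumes "\<bar>a\<bar> + \<bar>b\<bar> + \<bar>c\<bar> \<le> 1" "a * a + b * b + c * c = 1"
  shows "a \<noteq> 0 \<and> b = 0 \<and> c = 0 \<or> a = 0 \<and> b \<noteq> 0 \<and> c = 0 \<or> a = 0 \<and> b = 0 \<and> c \<noteq> 0"
proof -
  have "(\<bar>a\<bar> + \<bar>b\<bar> + \<bar>c\<bar>)\<^sup>2 \<le> 1" using assms(1) by (simp add: power_le_one)
  moreover have "(\<bar>a\<bar> + \<bar>b\<bar> + \<bar>c\<bar>)\<^sup>2
      = (a * a + b * b + c * c) + 2 * (\<bar>a * b\<bar> + \<bar>a * c\<bar> + \<bar>b * c\<bar>)"
    by (simp add: power2_eq_square algebra_simps abs_mult)
  ultimately have "1 + 2 * (\<bar>a * b\<bar> + \<bar>a * c\<bar> + \<bar>b * c\<bar>) \<le> 1"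
    by (simp only: assms(2))
  then have "\<bar>a * b\<bar> \<le> 0" "\<bar>a * c\<bar> \<le> 0" "\<bar>b * c\<bar> \<le> 0"
    using abs_ge_zero[of "a * b"] abs_ge_zero[of "a * c"] abs_ge_zero[of "b * c"] by simp_all
  then have "a * b = 0" "a * c = 0" "b * c = 0" by simp_all
  then show ?thesis using assms(2) by auto
qed

text \<open>Counting nonzero entries of a difference vector lets the linear part of an isometry act
  on the Hamming distance.\<close>

lemma hdist_embed:
  "hdist p q = (\<Sum>i\<in>UNIV. of_bool ((embed p - embed q) $ i \<noteq> 0))"
  by (cases p; cases q) (simp add: sum_3 hdist.simps)

lemma cube_isometry_hamming:
  fixes g :: "real ^ 3 \<Rightarrow> real ^ 3"
  assumes N: "N \<ge> 2" and f: "f \<in> Bij (grid N)"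
    and iso: "\<And>x y. dist (g x) (g y) = dist x y"
    and cube: "g ` solid_cube N = solid_cube N" and res: "restricts_to N g f"
  shows "f \<in> hamming_group N"
proof -
  \<comment> \<open>An isometry that fixes the origin is linear and orthogonal; the translation part
    cancels in every difference \<open>g x - g y\<close>.\<close>
  define h where "h = (\<lambda>x. g x - g 0)"
  have "orthogonal_transformation h"
    unfolding orthogonal_transformation_isometry h_def using iso by (auto simp: dist_norm)
  then have lin: "linear h" and om: "orthogonal_matrix (matrix h)"
    by (simp_all add: orthogonal_transformation_matrix)
  define A where "A = matrix h"
  have diff: "g x - g y = A *v (x - y)" for x y
    using matrix_works[OF lin[folded linear_matrix_vector_mul_eq], of "x - y"] linear_diff[OF lin]
    by (simp add: A_def h_def)
  have "A ** transpose A = mat 1" "transpose A ** A = mat 1"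
    using om by (simp_all add: orthogonal_matrix_def A_def)
  then have "(A ** transpose A) $ i $ i = 1" "(transpose A ** A) $ i $ i = 1" for i
    by (simp_all add: mat_def)
  then have row_norm: "A$i$1 * A$i$1 + A$i$2 * A$i$2 + A$i$3 * A$i$3 = 1"
    and col_norm: "A$1$i * A$1$i + A$2$i * A$2$i + A$3$i * A$3$i = 1" for i
    by (simp_all add: matrix_matrix_mult_def transpose_def sum_3)
  have row_sum: "\<bar>A$i$1\<bar> + \<bar>A$i$2\<bar> + \<bar>A$i$3\<bar> \<le> 1" for i
  proof -
    \<comment> \<open>opposite vertices of the cube, chosen so that row i of A picks up its absolute sum\<close>
    define P :: "real ^ 3" where "P = (\<chi> j. if A$i$j \<ge> 0 then real N else 1)"
    define Q :: "real ^ 3" where "Q = (\<chi> j. if A$i$j \<ge> 0 then 1 else real N)"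
    have "P \<in> solid_cube N" "Q \<in> solid_cube N"
      using N by (auto simp: P_def Q_def solid_cube_def mem_box_cart)
    then have "g P \<in> solid_cube N" "g Q \<in> solid_cube N" using cube by auto
    then have "g P $ i \<le> real N" "g Q $ i \<ge> 1"
      by (auto simp: solid_cube_def mem_box_cart)
    then have "(g P - g Q) $ i \<le> real N - 1" by simp
    moreover have "(g P - g Q) $ i = (real N - 1) * (\<bar>A$i$1\<bar> + \<bar>A$i$2\<bar> + \<bar>A$i$3\<bar>)"
    proof -
      have "A$i$j * (P - Q)$j = (real N - 1) * \<bar>A$i$j\<bar>" for j
        by (simp add: P_def Q_def algebra_simps)
      then show ?thesis
        unfolding diff by (simp add: matrix_vector_mult_def sum_3 distrib_left del: vector_minus_component)
    qed
    ultimately have "(real N - 1) * (\<bar>A$i$1\<bar> + \<bar>A$i$2\<bar> + \<bar>A$i$3\<bar>) \<le> (real N - 1) * 1" by simp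
    then show ?thesis using N by (subst (asm) mult_le_cancel_left_pos) auto
  qed
  note row = one_nonzero_coordinate[OF row_sum row_norm]
  have col: "A$1$i \<noteq> 0 \<or> A$2$i \<noteq> 0 \<or> A$3$i \<noteq> 0" for i using col_norm[of i] by auto
  have "hdist (f p) (f q) = hdist p q" if "p \<in> grid N" "q \<in> grid N" for p q
  proof -
    have *: "embed (f p) - embed (f q) = A *v (embed p - embed q)"
      using res that by (simp add: restricts_to_def diff)
    \<comment> \<open>Each row has exactly one nonzero entry, which gives 27 patterns. If two rows
      share a column, another column is zero, against \<open>col\<close>. In the six other patterns
      A permutes the coordinates up to nonzero factors, so the number of nonzero entries is
      kept.\<close>
    show ?thesis unfolding hdist_embed *
      using row[of 1] row[of 2] row[of 3] col[of 1] col[of 2] col[of 3]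
      by (elim disjE conjE)
         (simp_all add: matrix_vector_mult_def sum_3 del: vector_minus_component)
  qed
  then show ?thesis using f by (simp add: hamming_group_def)
qed

lemma rotation_isometry:
  assumes "is_rotation g"
  shows "dist (g x) (g y) = dist x y"
proof -
  obtain A b where "rotation_matrix A" and g: "g = (\<lambda>x. A *v x + b)"
    using assms by (auto simp: is_rotation_def)
  then have "orthogonal_transformation ((*v) A)"
    by (simp add: rotation_matrix_def orthogonal_transformation_matrix)
  then show ?thesis by (simp add: orthogonal_transformation_isometry g)
qed

text \<open>The base point p cancels in \<open>g x - g y = d - k *\<^sub>R n\<close>. Since
  \<open>k * (n \<bullet> n) = 2 * (d \<bullet> n)\<close>, the cross term and the square term in
  its squared norm cancel.\<close>

lemma reflection_isometry:
  assumes "is_reflection g"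
  shows "dist (g x) (g y) = dist x y"
proof -
  obtain n p where n: "n \<noteq> 0" and g: "g = (\<lambda>x. x - (2 * ((x - p) \<bullet> n) / (n \<bullet> n)) *\<^sub>R n)"
    using assms by (auto simp: is_reflection_def)
  define d where "d = x - y"
  define k where "k = 2 * (d \<bullet> n) / (n \<bullet> n)"
  have k: "k * (n \<bullet> n) = 2 * (d \<bullet> n)" using n by (simp add: k_def)
  have "g x - g y = d - k *\<^sub>R n"
    by (simp add: g d_def k_def algebra_simps inner_diff_left diff_divide_distrib)
  moreover have "(d - k *\<^sub>R n) \<bullet> (d - k *\<^sub>R n) = d \<bullet> d - 2 * k * (d \<bullet> n) + k * (k * (n \<bullet> n))"
    by (simp add: inner_diff_left inner_diff_right inner_commute algebra_simps)
  ultimately have "norm (g x - g y) = norm d" by (simp add: norm_eq k)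
  then show ?thesis by (simp add: dist_norm d_def)
qed

lemma cube_group_subset_hamming_group:
  assumes "N \<ge> 2"
  shows "cube_group N \<subseteq> hamming_group N"
proof -
  have "rotational_symmetries N \<subseteq> hamming_group N"
  proof
    fix f assume "f \<in> rotational_symmetries N"
    then obtain g where "f \<in> Bij (grid N)" "is_rotation g" "g ` solid_cube N = solid_cube N" "restricts_to N g f"
      unfolding rotational_symmetries_def by blast
    then show "f \<in> hamming_group N" by (intro cube_isometry_hamming[OF assms, of f g] rotation_isometry)
  qed
  moreover have "reflectional_symmetries N \<subseteq> hamming_group N"
  proof
    fix f assume "f \<in> reflectional_symmetries N"
    then obtain g where "f \<in> Bij (grid N)" "is_reflection g" "g ` solid_cube N = solid_cube N" "restricts_to N g f"
      unfolding reflectional_symmetries_def by blast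
    then show "f \<in> hamming_group N" by (intro cube_isometry_hamming[OF assms, of f g] reflection_isometry)
  qed
  ultimately show ?thesis using layer_interchanges_subset unfolding cube_group_def
    by (intro group.generate_subgroup_incl[OF group_BijGroup _ subgroup_hamming_group] Un_least)
qed

section \<open>The exceptional case N = 2\<close>

text \<open>Two distinct indices exhaust \<open>{1..2}\<close>, so a box can only be the whole grid,
  which every bijection maps onto itself.\<close>

lemma box_group_2: "box_group 2 = Bij (grid 2)"
proof -
  have "B = grid 2" if box: "is_box 2 B" for B
  proof -
    obtain i1 i2 j1 j2 k1 k2 where
      "i1 \<in> {1..2}" "i2 \<in> {1..2}" "j1 \<in> {1..2}" "j2 \<in> {1..2}" "k1 \<in> {1..2}" "k2 \<in> {1..2}"
      "i1 \<noteq> i2" "j1 \<noteq> j2" "k1 \<noteq> k2" and B: "B = {i1, i2} \<times> {j1, j2} \<times> {k1, k2}"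
      using box unfolding is_box_def by (elim bexE conjE) (rule that)
    moreover have "{i, j} = {1..2}" if "i \<in> {1..2}" "j \<in> {1..2}" "i \<noteq> j" for i j :: nat
      using that by auto
    ultimately have "{i1, i2} = {1..2}" "{j1, j2} = {1..2}" "{k1, k2} = {1..2}" by blast+
    then show ?thesis by (simp only: B grid_def)
  qed
  then have "is_box 2 (f ` B)" if "f \<in> Bij (grid 2)" "is_box 2 B" for f B
    using that BijD(2)[OF that(1)] by metis
  then show ?thesis unfolding box_group_def by blast
qed

lemma box_group_2_not_hamming: "\<not> box_group 2 \<subseteq> hamming_group 2"
proof
  assume *: "box_group 2 \<subseteq> hamming_group 2"
  \<comment> \<open>Exchanging (1,1,1) with (1,1,2) and fixing (2,1,1) raises the distance between
    (1,1,1) and (2,1,1) from 1 to 2.\<close>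
  define f where "f = restrict (Transposition.transpose (1, 1, 1) (1, 1, 2)) (grid 2)"
  have gr: "(1, 1, 1) \<in> grid 2" "(1, 1, 2) \<in> grid 2" "(2, 1, 1) \<in> grid 2" by (auto simp: grid_def)
  then have "f \<in> Bij (grid 2)"
    using bij_betw_transpose_iff[of "(1, 1, 1)" "grid 2" "(1, 1, 2)"] permutes_imp_bij[OF permutes_swap_id]
    by (simp add: f_def Bij_def bij_betw_restrict_eq)
  then have "hdist (f (1, 1, 1)) (f (2, 1, 1)) = hdist (1, 1, 1) (2, 1, 1)"
    using * gr by (auto simp: box_group_2 hamming_group_def)
  then show False using gr by (simp add: f_def hdist.simps Transposition.transpose_def)
qed

section \<open>Axis permutations and axis swaps inside the cube group\<close>

lemma generators_subset_carrier:
  "layer_interchanges N \<union> rotational_symmetries N \<union> reflectional_symmetries N \<subseteq> carrier (BijGroup (grid N))"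
proof -
  have "layer_interchanges N \<subseteq> Bij (grid N)"
    using layer_interchanges_subset unfolding hamming_group_def by blast
  then show ?thesis
    unfolding rotational_symmetries_def reflectional_symmetries_def by (simp add: BijGroup_def)
qed

lemma subgroup_cube_group: "subgroup (cube_group N) (BijGroup (grid N))"
  unfolding cube_group_def
  by (rule group.generate_is_subgroup[OF group_BijGroup generators_subset_carrier])

lemma cube_group_subset_Bij: "cube_group N \<subseteq> Bij (grid N)"
  using subgroup.subset[OF subgroup_cube_group] by (simp add: BijGroup_def)

lemma BijGroup_mult: "f \<in> Bij S \<Longrightarrow> g \<in> Bij S \<Longrightarrow> f \<otimes>\<^bsub>BijGroup S\<^esub> g = compose S f g"
  by (simp add: BijGroup_def)

lemma compose_cube_group:
  assumes "f \<in> cube_group N" "g \<in> cube_group N"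
  shows "compose (grid N) f g \<in> cube_group N"
proof -
  have "f \<in> Bij (grid N)" "g \<in> Bij (grid N)" using assms cube_group_subset_Bij by blast+
  then show ?thesis
    using subgroup.m_closed[OF subgroup_cube_group assms] by (simp only: BijGroup_mult)
qed

lemma compose_hamming_group:
  assumes "f \<in> hamming_group N" "g \<in> hamming_group N"
  shows "compose (grid N) f g \<in> hamming_group N"
proof -
  have "f \<in> Bij (grid N)" "g \<in> Bij (grid N)" using assms by (simp_all add: hamming_group_def)
  then show ?thesis
    using subgroup.m_closed[OF subgroup_hamming_group assms] by (simp only: BijGroup_mult)
qed

text \<open>Each normalisation below follows f by a known member g of the cube group; multiplying by
  the inverse of g undoes it.\<close>

lemma cube_group_cancel:
  assumes "f \<in> Bij (grid N)" "g \<in> cube_group N" "compose (grid N) g f \<in> cube_group N"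
  shows "f \<in> cube_group N"
proof -
  let ?G = "BijGroup (grid N)"
  interpret group ?G by (rule group_BijGroup)
  have c: "f \<in> carrier ?G" "g \<in> carrier ?G"
    using assms cube_group_subset_Bij[of N] by (auto simp: BijGroup_def)
  have "g \<otimes>\<^bsub>?G\<^esub> f \<in> cube_group N"
    using assms cube_group_subset_Bij[of N] by (subst BijGroup_mult) auto
  then have "inv\<^bsub>?G\<^esub> g \<otimes>\<^bsub>?G\<^esub> (g \<otimes>\<^bsub>?G\<^esub> f) \<in> cube_group N"
    using subgroup.m_closed[OF subgroup_cube_group] subgroup.m_inv_closed[OF subgroup_cube_group] assms(2) by blast
  then show ?thesis using c by (simp add: m_assoc[symmetric])
qed

lemma one_in_cube_group: "(\<lambda>x\<in>grid N. x) \<in> cube_group N"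
  using subgroup.one_closed[OF subgroup_cube_group[of N]] by (simp add: BijGroup_def)

lemma layer_interchange_cube_group:
  "layer_interchanges N \<union> reflectional_symmetries N \<subseteq> cube_group N"
  unfolding cube_group_def by (auto intro: generate.incl)

lemma compose_coord_map:
  assumes "\<alpha>' permutes {1..N}" "\<beta>' permutes {1..N}" "\<gamma>' permutes {1..N}"
  shows "compose (grid N) (coord_map N \<alpha> \<beta> \<gamma>) (coord_map N \<alpha>' \<beta>' \<gamma>') = coord_map N (\<alpha> \<circ> \<alpha>') (\<beta> \<circ> \<beta>') (\<gamma> \<circ> \<gamma>')"
proof
  fix p
  show "compose (grid N) (coord_map N \<alpha> \<beta> \<gamma>) (coord_map N \<alpha>' \<beta>' \<gamma>') p = coord_map N (\<alpha> \<circ> \<alpha>') (\<beta> \<circ> \<beta>') (\<gamma> \<circ> \<gamma>') p"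
    using assms[THEN permutes_in_image]
    by (cases p) (auto simp: compose_def coord_map_def grid_def)
qed

text \<open>Transpositions generate the symmetric group, so induction over products of
  transpositions handles one axis at a time. The general map is the composition of three one-axis
  maps.\<close>

lemma coord_map_cube_group:
  assumes "\<alpha> permutes {1..N}" "\<beta> permutes {1..N}" "\<gamma> permutes {1..N}"
  shows "coord_map N \<alpha> \<beta> \<gamma> \<in> cube_group N"
proof -
  have id: "coord_map N id id id \<in> cube_group N"
    using one_in_cube_group by (simp add: coord_map_def case_prod_unfold)
  have gen: "coord_map N (Transposition.transpose a b) id id \<in> cube_group N"
    "coord_map N id (Transposition.transpose a b) id \<in> cube_group N"
    "coord_map N id id (Transposition.transpose a b) \<in> cube_group N"
    if "a \<in> {1..N}" "b \<in> {1..N}" "a \<noteq> b" for a b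
    using that layer_interchange_cube_group[of N] unfolding layer_interchanges_eq by blast+
  have c1: "coord_map N \<alpha> id id \<in> cube_group N" if "\<alpha> permutes {1..N}" for \<alpha>
    using that finite_atLeastAtMost
  proof (induction \<alpha> rule: permutes_induct)
    case (swap a b p)
    then show ?case
      using compose_cube_group[OF gen(1)[OF swap.hyps(1-3)] swap.IH]
      by (simp only: compose_coord_map[OF swap.hyps(4) permutes_id permutes_id] comp_id id_comp)
  qed (rule id)
  have c2: "coord_map N id \<alpha> id \<in> cube_group N" if "\<alpha> permutes {1..N}" for \<alpha>
    using that finite_atLeastAtMost
  proof (induction \<alpha> rule: permutes_induct)
    case (swap a b p)
    then show ?case
      using compose_cube_group[OF gen(2)[OF swap.hyps(1-3)] swap.IH]
      by (simp only: compose_coord_map[OF permutes_id swap.hyps(4) permutes_id] comp_id id_comp)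
  qed (rule id)
  have c3: "coord_map N id id \<alpha> \<in> cube_group N" if "\<alpha> permutes {1..N}" for \<alpha>
    using that finite_atLeastAtMost
  proof (induction \<alpha> rule: permutes_induct)
    case (swap a b p)
    then show ?case
      using compose_cube_group[OF gen(3)[OF swap.hyps(1-3)] swap.IH]
      by (simp only: compose_coord_map[OF permutes_id permutes_id swap.hyps(4)] comp_id id_comp)
  qed (rule id)
  have "compose (grid N) (coord_map N \<alpha> id id) (compose (grid N) (coord_map N id \<beta> id) (coord_map N id id \<gamma>))
      \<in> cube_group N"
    using assms by (intro compose_cube_group c1 c2 c3)
  then show ?thesis
    by (simp only: compose_coord_map[OF permutes_id permutes_id assms(3)]
        compose_coord_map[OF permutes_id assms(2,3)] comp_id id_comp)
qed

definition swap12 :: "nat \<Rightarrow> point \<Rightarrow> point" where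
  "swap12 N = (\<lambda>(i, j, k)\<in>grid N. (j, i, k))"

definition swap23 :: "nat \<Rightarrow> point \<Rightarrow> point" where
  "swap23 N = (\<lambda>(i, j, k)\<in>grid N. (i, k, j))"

lemma swap_hamming: "swap12 N \<in> hamming_group N" "swap23 N \<in> hamming_group N"
proof -
  show "swap12 N \<in> hamming_group N"
  proof (rule hamming_groupI)
    show "hdist (swap12 N p) (swap12 N q) = hdist p q" if "p \<in> grid N" "q \<in> grid N" for p q
      using that by (cases p; cases q) (simp add: swap12_def hdist.simps)
  qed (auto simp: swap12_def grid_def)
  show "swap23 N \<in> hamming_group N"
  proof (rule hamming_groupI)
    show "hdist (swap23 N p) (swap23 N q) = hdist p q" if "p \<in> grid N" "q \<in> grid N" for p q
      using that by (cases p; cases q) (simp add: swap23_def hdist.simps)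
  qed (auto simp: swap23_def grid_def)
qed

lemma involution_image: "(\<And>x. g (g x) = x) \<Longrightarrow> (\<And>x. x \<in> S \<Longrightarrow> g x \<in> S) \<Longrightarrow> g ` S = S"
  by (metis image_subset_iff subsetI subset_antisym image_eqI)

lemma vec3_eqI: "x $ 1 = y $ 1 \<Longrightarrow> x $ 2 = y $ 2 \<Longrightarrow> x $ 3 = y $ 3 \<Longrightarrow> x = (y :: real ^ 3)"
  by (simp add: vec_eq_iff forall_3)

lemma swap_cube_group: "swap12 N \<in> cube_group N" "swap23 N \<in> cube_group N"
proof -
  define g :: "real ^ 3 \<Rightarrow> real ^ 3" where "g x = vector [x $ 2, x $ 1, x $ 3]" for x
  have "is_reflection g" unfolding is_reflection_def
  proof (intro exI conjI)
    \<comment> \<open>Exchanging the first two coordinates is the reflection in the plane where they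
      are equal; this is its normal, and the plane passes through the base point 0.\<close>
    let ?n = "vector [1, -1, 0] :: real ^ 3"
    show "?n \<noteq> 0" by (metis vector_3(1) zero_index zero_neq_one)
    show "g = (\<lambda>x. x - (2 * ((x - 0) \<bullet> ?n) / (?n \<bullet> ?n)) *\<^sub>R ?n)"
      by (rule ext, rule vec3_eqI) (simp_all add: g_def inner_vec_def sum_3 field_simps)
  qed
  moreover have "g ` solid_cube N = solid_cube N"
    by (rule involution_image) (auto intro!: vec3_eqI simp: g_def solid_cube_def mem_box_cart forall_3)
  moreover have "restricts_to N g (swap12 N)"
    by (auto simp: restricts_to_def g_def swap12_def)
  ultimately have "swap12 N \<in> reflectional_symmetries N"
    using swap_hamming(1) by (auto simp: reflectional_symmetries_def hamming_group_def)
  then show "swap12 N \<in> cube_group N" using layer_interchange_cube_group by blast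
next
  define g :: "real ^ 3 \<Rightarrow> real ^ 3" where "g x = vector [x $ 1, x $ 3, x $ 2]" for x
  have "is_reflection g" unfolding is_reflection_def
  proof (intro exI conjI)
    let ?n = "vector [0, 1, -1] :: real ^ 3"
    show "?n \<noteq> 0" by (metis vector_3(2) zero_index zero_neq_one)
    show "g = (\<lambda>x. x - (2 * ((x - 0) \<bullet> ?n) / (?n \<bullet> ?n)) *\<^sub>R ?n)"
      by (rule ext, rule vec3_eqI) (simp_all add: g_def inner_vec_def sum_3 field_simps)
  qed
  moreover have "g ` solid_cube N = solid_cube N"
    by (rule involution_image) (auto intro!: vec3_eqI simp: g_def solid_cube_def mem_box_cart forall_3)
  moreover have "restricts_to N g (swap23 N)"
    by (auto simp: restricts_to_def g_def swap23_def)
  ultimately have "swap23 N \<in> reflectional_symmetries N"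
    using swap_hamming(2) by (auto simp: reflectional_symmetries_def hamming_group_def)
  then show "swap23 N \<in> cube_group N" using layer_interchange_cube_group by blast
qed

section \<open>Reducing Hamming isometries to the identity\<close>

text \<open>The bracketing isolates the summand that depends on s, in the shape to which
  \<open>of_bool_shift_eq\<close> applies.\<close>

lemma hdist_axis_eq:
  "hdist (a, b, c) (s, 1, 1) = of_bool (a \<noteq> s) + (of_bool (b \<noteq> 1) + of_bool (c \<noteq> 1))"
  "hdist (a, b, c) (1, s, 1) = of_bool (b \<noteq> s) + (of_bool (a \<noteq> 1) + of_bool (c \<noteq> 1))"
  "hdist (a, b, c) (1, 1, s) = of_bool (c \<noteq> s) + (of_bool (a \<noteq> 1) + of_bool (b \<noteq> 1))"
  by (simp_all add: hdist.simps)

text \<open>If a' and a differed, the two equations would read \<open>1 + m = n\<close> and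
  \<open>m = 1 + n\<close>. In the application m and n are the contributions of the other two
  coordinates: along an axis, the distance to a point drops only at that point's own
  coordinate.\<close>

lemma of_bool_shift_eq:
  fixes m n :: nat
  assumes "of_bool (a' \<noteq> a) + m = of_bool (a \<noteq> a) + n" "of_bool (a' \<noteq> a') + m = of_bool (a \<noteq> a') + n"
  shows "a' = a"
  using assms by (cases "a' = a") auto

lemma fixes_axes_imp_id:
  assumes f: "f \<in> hamming_group N"
    and ax: "\<And>x. x \<in> {1..N} \<Longrightarrow> f (x, 1, 1) = (x, 1, 1)" "\<And>x. x \<in> {1..N} \<Longrightarrow> f (1, x, 1) = (1, x, 1)"
      "\<And>x. x \<in> {1..N} \<Longrightarrow> f (1, 1, x) = (1, 1, x)"
    and p: "p \<in> grid N"
  shows "f p = p"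
proof -
  obtain a b c where abc: "p = (a, b, c)" by (metis prod_cases3)
  obtain a' b' c' where abc': "f p = (a', b', c')" by (metis prod_cases3)
  have d: "hdist (f p) (f q) = hdist p q" if "q \<in> grid N" for q
    using f p that by (auto simp: hamming_group_def)
  have "(a', b', c') \<in> grid N"
    using f p unfolding abc'[symmetric] by (auto simp: hamming_group_def intro: BijD(3))
  then have m: "a \<in> {1..N}" "b \<in> {1..N}" "c \<in> {1..N}" "a' \<in> {1..N}" "b' \<in> {1..N}" "c' \<in> {1..N}" "1 \<in> {1..N}"
    using p unfolding abc by (auto simp: grid_def)
  have "hdist (a', b', c') (x, 1, 1) = hdist (a, b, c) (x, 1, 1)"
    "hdist (a', b', c') (1, x, 1) = hdist (a, b, c) (1, x, 1)"
    "hdist (a', b', c') (1, 1, x) = hdist (a, b, c) (1, 1, x)" if "x \<in> {1..N}" for x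
    using d[of "(x, 1, 1)"] d[of "(1, x, 1)"] d[of "(1, 1, x)"] ax[OF that] that m(7)
    unfolding abc' by (simp_all add: abc grid_def)
  note e = this[unfolded hdist_axis_eq]
  have "a' = a" by (rule of_bool_shift_eq[OF e(1)[OF m(1)] e(1)[OF m(4)]])
  moreover have "b' = b" by (rule of_bool_shift_eq[OF e(2)[OF m(2)] e(2)[OF m(5)]])
  moreover have "c' = c" by (rule of_bool_shift_eq[OF e(3)[OF m(3)] e(3)[OF m(6)]])
  ultimately show ?thesis using abc abc' by simp
qed

text \<open>On each axis f induces a permutation. Following f by the coordinate map of the three
  inverse permutations fixes all axis points, and \<open>fixes_axes_imp_id\<close> makes the
  composition the identity.\<close>

lemma preserves_axes_imp_cube_group:
  assumes f: "f \<in> hamming_group N"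
    and ax: "\<And>x. x \<in> {1..N} \<Longrightarrow> \<exists>y. f (x, 1, 1) = (y, 1, 1)" "\<And>x. x \<in> {1..N} \<Longrightarrow> \<exists>y. f (1, x, 1) = (1, y, 1)"
      "\<And>x. x \<in> {1..N} \<Longrightarrow> \<exists>y. f (1, 1, x) = (1, 1, y)"
    and f1: "f (1, 1, 1) = (1, 1, 1)" and N: "N \<ge> 1"
  shows "f \<in> cube_group N"
proof -
  have B: "f \<in> Bij (grid N)" using f by (simp add: hamming_group_def)
  have one: "1 \<in> {1..N}" using N by simp
  \<comment> \<open>Outside \<open>{1..N}\<close> the value is x itself, since
    \<open>permutes\<close> demands the identity there.\<close>
  define \<alpha> where "\<alpha> x = (if x \<in> {1..N} then fst (f (x, 1, 1)) else x)" for x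
  define \<beta> where "\<beta> x = (if x \<in> {1..N} then fst (snd (f (1, x, 1))) else x)" for x
  define \<gamma> where "\<gamma> x = (if x \<in> {1..N} then snd (snd (f (1, 1, x))) else x)" for x
  have fa: "f (x, 1, 1) = (\<alpha> x, 1, 1)" "f (1, x, 1) = (1, \<beta> x, 1)" "f (1, 1, x) = (1, 1, \<gamma> x)"
    if "x \<in> {1..N}" for x
    using ax[OF that] that by (auto simp: \<alpha>_def \<beta>_def \<gamma>_def)
  have gr: "(x, 1, 1) \<in> grid N" "(1, x, 1) \<in> grid N" "(1, 1, x) \<in> grid N" if "x \<in> {1..N}" for x
    using that one by (simp_all add: grid_def)
  \<comment> \<open>Stated for any embedding e of an axis, so that one argument serves all
    three.\<close>
  have perm: "\<pi> permutes {1..N}"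
    if "\<And>x. x \<in> {1..N} \<Longrightarrow> e x \<in> grid N" "\<And>x. x \<in> {1..N} \<Longrightarrow> f (e x) = e (\<pi> x)"
      "\<And>x. e x \<in> grid N \<Longrightarrow> x \<in> {1..N}" "inj e" "\<And>x. x \<notin> {1..N} \<Longrightarrow> \<pi> x = x" for \<pi> and e :: "nat \<Rightarrow> point"
  proof (rule bij_imp_permutes)
    have "\<pi> ` {1..N} \<subseteq> {1..N}" using that(1-3) BijD(3)[OF B] by (metis image_subsetI)
    moreover have "inj_on \<pi> {1..N}"
      using that(1,2,4) BijD(1)[OF B] by (metis (no_types, lifting) inj_on_def injD)
    ultimately show "bij_betw \<pi> {1..N} {1..N}" by (simp add: bij_betw_def endo_inj_surj)
  qed (rule that(5))
  have pa: "\<alpha> permutes {1..N}"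
    by (rule perm[of "\<lambda>x. (x, 1, 1)"], erule gr(1), erule fa(1))
      (auto simp: grid_def inj_def \<alpha>_def)
  have pb: "\<beta> permutes {1..N}"
    by (rule perm[of "\<lambda>x. (1, x, 1)"], erule gr(2), erule fa(2))
      (auto simp: grid_def inj_def \<beta>_def)
  have pc: "\<gamma> permutes {1..N}"
    by (rule perm[of "\<lambda>x. (1, 1, x)"], erule gr(3), erule fa(3))
      (auto simp: grid_def inj_def \<gamma>_def)
  note perms = pa pb pc
  \<comment> \<open>An axis point has two coordinates equal to 1, and the inverse permutations must
    leave those alone.\<close>
  have fix1: "\<alpha> 1 = 1" "\<beta> 1 = 1" "\<gamma> 1 = 1" using f1 one by (simp_all add: \<alpha>_def \<beta>_def \<gamma>_def)
  then have inv1: "inv_into UNIV \<alpha> 1 = 1" "inv_into UNIV \<beta> 1 = 1" "inv_into UNIV \<gamma> 1 = 1"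
    using perms by (metis permutes_inverses(2))+
  define g where "g = coord_map N (inv_into UNIV \<alpha>) (inv_into UNIV \<beta>) (inv_into UNIV \<gamma>)"
  have gG: "g \<in> cube_group N" and gH: "g \<in> hamming_group N"
    unfolding g_def using perms[THEN permutes_inv] by (simp_all add: coord_map_cube_group coord_map_hamming)
  have g: "g (\<alpha> x, 1, 1) = (x, 1, 1)" "g (1, \<beta> x, 1) = (1, x, 1)" "g (1, 1, \<gamma> x) = (1, 1, x)" if "x \<in> {1..N}" for x
  proof -
    have "\<alpha> x \<in> {1..N}" "\<beta> x \<in> {1..N}" "\<gamma> x \<in> {1..N}" using perms[THEN permutes_in_image] that by blast+
    then show "g (\<alpha> x, 1, 1) = (x, 1, 1)" "g (1, \<beta> x, 1) = (1, x, 1)" "g (1, 1, \<gamma> x) = (1, 1, x)"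
      by (simp_all only: g_def coord_map_apply gr inv1 perms[THEN permutes_inverses(2)])
  qed
  have "compose (grid N) g f p = p" if "p \<in> grid N" for p
    by (rule fixes_axes_imp_id[OF compose_hamming_group[OF gH f] _ _ _ that])
       (simp_all only: compose_eq gr fa g)
  then have "compose (grid N) g f = (\<lambda>x\<in>grid N. x)" by (auto simp: compose_def fun_eq_iff)
  then show ?thesis using cube_group_cancel[OF B gG] one_in_cube_group by metis
qed

text \<open>Points other than the corner on two different axes are at distance 2, so a neighbour of
  (1,1,1) within distance 1 of an axis point other than the corner lies on the same axis.\<close>

lemma hdist_axis:
  assumes "hdist (1, 1, 1) (u, v, w) = 1"
  shows "s \<noteq> 1 \<Longrightarrow> hdist (s, 1, 1) (u, v, w) \<le> 1 \<Longrightarrow> v = 1 \<and> w = 1"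
    and "s \<noteq> 1 \<Longrightarrow> hdist (1, s, 1) (u, v, w) \<le> 1 \<Longrightarrow> u = 1 \<and> w = 1"
    and "s \<noteq> 1 \<Longrightarrow> hdist (1, 1, s) (u, v, w) \<le> 1 \<Longrightarrow> u = 1 \<and> v = 1"
  using assms unfolding hdist.simps
  by (cases "u = 1"; cases "v = 1"; cases "w = 1"; simp)+

lemma hdist_one_cases:
  assumes "hdist (1, 1, 1) p = 1"
  obtains s where "s \<noteq> 1" "p = (s, 1, 1)" | s where "s \<noteq> 1" "p = (1, s, 1)" | s where "s \<noteq> 1" "p = (1, 1, s)"
proof -
  obtain u v w where p: "p = (u, v, w)" by (metis prod_cases3)
  show thesis
    using assms that unfolding p hdist.simps
    by (cases "u = 1"; cases "v = 1"; cases "w = 1") auto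
qed


declare One_nat_def [simp del]

text \<open>The points with coordinate 2 mark the three axes. Once each marker is known to stay on
  its axis, it keeps the rest of the axis there too, because distinct points of one axis are at
  distance 1.\<close>

lemma hamming_fixing_two_axes:
  assumes f: "f \<in> hamming_group N" and N: "N \<ge> 2" and f1: "f (1, 1, 1) = (1, 1, 1)"
    and s: "f (2, 1, 1) = (s, 1, 1)" and t: "f (1, 2, 1) = (1, t, 1)"
  shows "f \<in> cube_group N"
proof -
  have d: "hdist (f p) (f q) = hdist p q" if "p \<in> grid N" "q \<in> grid N" for p q
    using f that by (simp add: hamming_group_def)
  have gr: "(x, 1, 1) \<in> grid N" "(1, x, 1) \<in> grid N" "(1, 1, x) \<in> grid N" if "x \<in> {1..N}" for x
    using that by (auto simp: grid_def)
  have 12: "1 \<in> {1..N}" "2 \<in> {1..N}" using N by auto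
  note g = gr[OF 12(1)] gr[OF 12(2)]
  have st: "s \<noteq> 1" "t \<noteq> 1"
    using d[OF g(4) g(1)] d[OF g(5) g(1)] unfolding s t f1 hdist.simps by auto
  have "hdist (1, 1, 1) (f (1, 1, 2)) = 1" using d[OF g(1) g(6)] by (simp add: f1 hdist.simps)
  \<comment> \<open>The third marker is at distance 2 from the other two, so its image cannot share
    an axis with either of theirs.\<close>
  then obtain r where r: "f (1, 1, 2) = (1, 1, r)" "r \<noteq> 1"
  proof (cases rule: hdist_one_cases)
    case (1 u)
    then show ?thesis using d[OF g(4) g(6)] by (auto simp: s hdist.simps of_bool_def split: if_splits)
  next
    case (2 u)
    then show ?thesis using d[OF g(5) g(6)] by (auto simp: t hdist.simps of_bool_def split: if_splits)
  qed (use that in auto)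
  have weight: "hdist (1, 1, 1) (f q) = 1" if "q \<in> grid N" "hdist (1, 1, 1) q = 1" for q
    using d[OF g(1) that(1)] that(2) by (simp add: f1)
  show ?thesis
  proof (rule preserves_axes_imp_cube_group[OF f _ _ _ f1])
    show "\<exists>y. f (x, 1, 1) = (y, 1, 1)" if x: "x \<in> {1..N}" for x
    proof (cases "x = 1")
      case False
      obtain u v w where uvw: "f (x, 1, 1) = (u, v, w)" by (metis prod_cases3)
      have "hdist (1, 1, 1) (u, v, w) = 1"
        using weight[OF gr(1)[OF x]] False by (simp add: uvw hdist.simps)
      moreover have "hdist (s, 1, 1) (u, v, w) \<le> 1"
        using d[OF g(4) gr(1)[OF x]] by (simp add: s uvw hdist.simps(1)[of 2])
      ultimately have "v = 1 \<and> w = 1" using hdist_axis(1) st by blast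
      then show ?thesis using uvw by blast
    qed (use f1 in blast)
    show "\<exists>y. f (1, x, 1) = (1, y, 1)" if x: "x \<in> {1..N}" for x
    proof (cases "x = 1")
      case False
      obtain u v w where uvw: "f (1, x, 1) = (u, v, w)" by (metis prod_cases3)
      have "hdist (1, 1, 1) (u, v, w) = 1"
        using weight[OF gr(2)[OF x]] False by (simp add: uvw hdist.simps)
      moreover have "hdist (1, t, 1) (u, v, w) \<le> 1"
        using d[OF g(5) gr(2)[OF x]] by (simp add: t uvw hdist.simps(1)[of 1 2])
      ultimately have "u = 1 \<and> w = 1" using hdist_axis(2) st by blast
      then show ?thesis using uvw by blast
    qed (use f1 in blast)
    show "\<exists>y. f (1, 1, x) = (1, 1, y)" if x: "x \<in> {1..N}" for x
    proof (cases "x = 1")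
      case False
      obtain u v w where uvw: "f (1, 1, x) = (u, v, w)" by (metis prod_cases3)
      have "hdist (1, 1, 1) (u, v, w) = 1"
        using weight[OF gr(3)[OF x]] False by (simp add: uvw hdist.simps)
      moreover have "hdist (1, 1, r) (u, v, w) \<le> 1"
        using d[OF g(6) gr(3)[OF x]] by (simp add: r uvw hdist.simps(1)[of 1 1 2])
      ultimately have "u = 1 \<and> v = 1" using hdist_axis(3) r by blast
      then show ?thesis using uvw by blast
    qed (use f1 in blast)
  qed (use N in simp)
qed

text \<open>The second marker goes to a neighbour of the corner off the first axis. If it lands on
  the third axis, \<open>swap23\<close> brings it back without disturbing the first.\<close>

lemma hamming_fixing_first_axis:
  assumes f: "f \<in> hamming_group N" and N: "N \<ge> 2" and f1: "f (1, 1, 1) = (1, 1, 1)"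
    and s: "f (2, 1, 1) = (s, 1, 1)"
  shows "f \<in> cube_group N"
proof -
  have B: "f \<in> Bij (grid N)" using f by (simp add: hamming_group_def)
  have gr: "(1, 1, 1) \<in> grid N" "(2, 1, 1) \<in> grid N" "(1, 2, 1) \<in> grid N" using N by (simp_all add: grid_def)
  have d: "hdist (f p) (f q) = hdist p q" if "p \<in> grid N" "q \<in> grid N" for p q
    using f that by (simp add: hamming_group_def)
  have "hdist (1, 1, 1) (f (1, 2, 1)) = 1" using d[OF gr(1,3)] by (simp add: f1 hdist.simps)
  then show ?thesis
  proof (cases rule: hdist_one_cases)
    case (1 u)
    then show ?thesis using d[OF gr(2,3)] by (auto simp: s hdist.simps of_bool_def split: if_splits)
  next
    case (2 t)
    show ?thesis by (rule hamming_fixing_two_axes[OF f N f1 s 2(2)])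
  next
    case (3 t)
    let ?g = "compose (grid N) (swap23 N) f"
    have m: "(s, 1, 1) \<in> grid N" "(1, 1, t) \<in> grid N" using s 3 gr BijD(3)[OF B] by metis+
    have "?g \<in> cube_group N"
    proof (rule hamming_fixing_two_axes[OF compose_hamming_group[OF swap_hamming(2) f] N])
      show "?g (1, 1, 1) = (1, 1, 1)" using gr f1 by (simp add: compose_eq swap23_def)
      show "?g (2, 1, 1) = (s, 1, 1)" using gr m s by (simp add: compose_eq swap23_def)
      show "?g (1, 2, 1) = (1, t, 1)" using gr m 3 by (simp add: compose_eq swap23_def)
    qed
    then show ?thesis by (rule cube_group_cancel[OF B swap_cube_group(2)])
  qed
qed

lemma hamming_fixing_corner:
  assumes f: "f \<in> hamming_group N" and N: "N \<ge> 2" and f1: "f (1, 1, 1) = (1, 1, 1)"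
  shows "f \<in> cube_group N"
proof -
  \<comment> \<open>Stated for a general h because it is applied both to f and to f followed by
    \<open>swap23\<close>: a first marker on the third axis is moved to the second, and from there
    to the first by \<open>swap12\<close>.\<close>
  have swap: "h \<in> cube_group N"
    if h: "h \<in> hamming_group N" "h (1, 1, 1) = (1, 1, 1)" "h (2, 1, 1) = (1, t, 1)" for h t
  proof -
    let ?g = "compose (grid N) (swap12 N) h"
    have B: "h \<in> Bij (grid N)" using h by (simp add: hamming_group_def)
    have gr: "(1, 1, 1) \<in> grid N" "(2, 1, 1) \<in> grid N" using N by (simp_all add: grid_def)
    have m: "(1, t, 1) \<in> grid N" using h gr BijD(3)[OF B] by metis
    have "?g \<in> cube_group N"
    proof (rule hamming_fixing_first_axis[OF compose_hamming_group[OF swap_hamming(1) h(1)] N])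
      show "?g (1, 1, 1) = (1, 1, 1)" using gr h by (simp add: compose_eq swap12_def)
      show "?g (2, 1, 1) = (t, 1, 1)" using gr m h by (simp add: compose_eq swap12_def)
    qed
    then show ?thesis by (rule cube_group_cancel[OF B swap_cube_group(1)])
  qed
  have B: "f \<in> Bij (grid N)" using f by (simp add: hamming_group_def)
  have gr: "(1, 1, 1) \<in> grid N" "(2, 1, 1) \<in> grid N" using N by (simp_all add: grid_def)
  have "hdist (f (1, 1, 1)) (f (2, 1, 1)) = hdist (1, 1, 1) (2, 1, 1)"
    using f gr by (simp add: hamming_group_def)
  then have "hdist (1, 1, 1) (f (2, 1, 1)) = 1" by (simp add: f1 hdist.simps)
  then show ?thesis
  proof (cases rule: hdist_one_cases)
    case (1 s)
    show ?thesis by (rule hamming_fixing_first_axis[OF f N f1 1(2)])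
  next
    case (2 t)
    show ?thesis by (rule swap[OF f f1 2(2)])
  next
    case (3 t)
    let ?g = "compose (grid N) (swap23 N) f"
    have m: "(1, 1, t) \<in> grid N" using 3 gr BijD(3)[OF B] by metis
    have "?g \<in> cube_group N"
    proof (rule swap[OF compose_hamming_group[OF swap_hamming(2) f]])
      show "?g (1, 1, 1) = (1, 1, 1)" using gr f1 by (simp add: compose_eq swap23_def)
      show "?g (2, 1, 1) = (1, t, 1)" using gr m 3 by (simp add: compose_eq swap23_def)
    qed
    then show ?thesis by (rule cube_group_cancel[OF B swap_cube_group(2)])
  qed
qed

lemma hamming_group_subset_cube_group:
  assumes N: "N \<ge> 2"
  shows "hamming_group N \<subseteq> cube_group N"
proof
  fix f assume f: "f \<in> hamming_group N"
  then have B: "f \<in> Bij (grid N)" by (simp add: hamming_group_def)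
  obtain a b c where abc: "f (1, 1, 1) = (a, b, c)" by (metis prod_cases3)
  have gr: "(1, 1, 1) \<in> grid N" using N by (simp add: grid_def)
  then have abc_grid: "(a, b, c) \<in> grid N" using abc BijD(3)[OF B] by metis
  then have perms: "Transposition.transpose a 1 permutes {1..N}" "Transposition.transpose b 1 permutes {1..N}"
    "Transposition.transpose c 1 permutes {1..N}"
    using N by (auto simp: grid_def intro!: permutes_swap_id)
  \<comment> \<open>This carries the image (a,b,c) of the corner back to (1,1,1). A coordinate
    already equal to 1 gives the trivial transposition, so no case distinction arises.\<close>
  let ?t = "coord_map N (Transposition.transpose a 1) (Transposition.transpose b 1) (Transposition.transpose c 1)"
  have "compose (grid N) ?t f \<in> cube_group N"
  proof (rule hamming_fixing_corner[OF compose_hamming_group[OF coord_map_hamming[OF perms] f] N])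
    show "compose (grid N) ?t f (1, 1, 1) = (1, 1, 1)"
      using gr abc_grid by (simp add: compose_eq abc coord_map_apply)
  qed
  then show "f \<in> cube_group N" by (rule cube_group_cancel[OF B coord_map_cube_group[OF perms]])
qed

theorem theorem1:
  fixes N :: nat
  assumes "N \<ge> 2"
  shows "subgroup (box_group N) (BijGroup (grid N))
    \<and> cube_group N \<subseteq> box_group N
    \<and> (N = 2 \<longrightarrow> cube_group N \<subset> box_group N)
    \<and> (N \<ge> 3 \<longrightarrow> box_group N = cube_group N)"
proof (intro conjI impI)
  show sub: "cube_group N \<subseteq> box_group N"
    using cube_group_subset_hamming_group[OF assms] hamming_group_subset_box_group by blast
  \<comment> \<open>The Hamming isometries separate the two groups: they contain the cube group for
    N = 2 as well, but not the box group.\<close>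
  show "cube_group N \<subset> box_group N" if "N = 2"
    using sub box_group_2_not_hamming cube_group_subset_hamming_group[OF assms] unfolding that by blast
  show "box_group N = cube_group N" if "N \<ge> 3"
    using sub box_group_subset_hamming_group[OF that] hamming_group_subset_cube_group[OF assms] by blast
qed (rule subgroup_box_group)

end
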